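(* Let $\phi:R\twoheadrightarrow\widetilde R$ be a surjective homomorphism of commutative associative rings. 1. Let $I_\bullet$ be a filtration of $R$ by ideals and suppose the completion map $R\to\widehat R^{(I_\bullet)}$ is surjective. Then the completion map $\widetilde R\to\widehat{\widetilde R}^{(\widetilde I_\bullet)}$ is surjective, where $\widetilde I_\bullet:=\phi(I_\bullet)\cdot\widetilde R$. 2. Let $\widetilde I_\bullet$ be a filtration of $\widetilde R$ by ideals and suppose the completion map $\widetilde R\to\widehat{\widetilde R}^{(\widetilde I_\bullet)}$ is surjective. Then the completion map $R\to\widehat R^{(I_\bullet)}$ is surjective, where $I_\bullet:=\phi^{-1}(\widetilde I_\bullet)$.
   Context: A filtration of a ring $R$ is a decreasing sequence of ideals $R=I_0\supseteq I_1\supseteq I_2\supseteq\cdots$. The completion is $\widehat R^{(I_\bullet)}:=\varprojlim_jR/I_j$ with its natural map $R\to\widehat R^{(I_\bullet)}$. *)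

theory Defs
  imports "HOL-Algebra.QuotRing" "HOL-Algebra.Ideal_Product"
begin

definition ring_filtration :: "('a, 'm) ring_scheme \<Rightarrow> (nat \<Rightarrow> 'a set) \<Rightarrow> bool" where
  "ring_filtration R I \<longleftrightarrow>
     (\<forall>j. ideal (I j) R) \<and> I 0 = carrier R \<and> (\<forall>j. I (Suc j) \<subseteq> I j)"

(* For ideals K \<subseteq> J this is the projection from R/K to R/J:
   the coset K + x is sent to J + (K + x) = J + x; see quot_proj_coset. *)
definition quot_proj :: "('a, 'm) ring_scheme \<Rightarrow> 'a set \<Rightarrow> 'a set \<Rightarrow> 'a set" where
  "quot_proj R J X = J <+>\<^bsub>R\<^esub> X"

definition completion :: "('a, 'm) ring_scheme \<Rightarrow> (nat \<Rightarrow> 'a set) \<Rightarrow> (nat \<Rightarrow> 'a set) ring" where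
  "completion R I =
     \<lparr>carrier = {x. (\<forall>j. x j \<in> carrier (R Quot I j)) \<and>
                    (\<forall>i j. i \<le> j \<longrightarrow> quot_proj R (I i) (x j) = x i)},
      mult = (\<lambda>x y j. x j \<otimes>\<^bsub>R Quot I j\<^esub> y j),
      one = (\<lambda>j. \<one>\<^bsub>R Quot I j\<^esub>),
      zero = (\<lambda>j. \<zero>\<^bsub>R Quot I j\<^esub>),
      add = (\<lambda>x y j. x j \<oplus>\<^bsub>R Quot I j\<^esub> y j)\<rparr>"

definition completion_map :: "('a, 'm) ring_scheme \<Rightarrow> (nat \<Rightarrow> 'a set) \<Rightarrow> 'a \<Rightarrow> nat \<Rightarrow> 'a set" where
  "completion_map R I r = (\<lambda>j. I j +>\<^bsub>R\<^esub> r)"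

(* J . S: the ideal of S formed by the finite sums of products a * s with a in J and s in S. *)
definition extended_ideal :: "('b, 'n) ring_scheme \<Rightarrow> 'b set \<Rightarrow> 'b set" where
  "extended_ideal S J = ideal_prod S J (carrier S)"

definition preimage_ideal ::
  "('a, 'm) ring_scheme \<Rightarrow> ('a \<Rightarrow> 'b) \<Rightarrow> 'b set \<Rightarrow> 'a set" where
  "preimage_ideal R \<phi> J = {r \<in> carrier R. \<phi> r \<in> J}"


text \<open>The definitions above do yield rings, ring homomorphisms and filtrations.\<close>

lemma ring_filtration_antimono:
  assumes "ring_filtration R I" "i \<le> j"
  shows "I j \<subseteq> I i"
  using assms lift_Suc_antimono_le[of I] unfolding ring_filtration_def by blast

lemma quot_proj_coset:
  assumes "ideal K R" "ideal J R" "K \<subseteq> J" "x \<in> carrier R"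
  shows "quot_proj R J (K +>\<^bsub>R\<^esub> x) = J +>\<^bsub>R\<^esub> x"
proof -
  interpret K: ideal K R by fact
  interpret J: ideal J R by fact
  have "J <+>\<^bsub>R\<^esub> K = J"
  proof
    show "J <+>\<^bsub>R\<^esub> K \<subseteq> J" using assms(3) by (auto simp: set_add_def')
    show "J \<subseteq> J <+>\<^bsub>R\<^esub> K"
    proof
      fix a assume "a \<in> J"
      then have "a \<oplus>\<^bsub>R\<^esub> \<zero>\<^bsub>R\<^esub> \<in> J <+>\<^bsub>R\<^esub> K"
        using additive_subgroup.zero_closed[OF K.is_additive_subgroup]
        unfolding set_add_def' by blast
      then show "a \<in> J <+>\<^bsub>R\<^esub> K" using \<open>a \<in> J\<close> by (simp add: J.a_Hcarr)
    qed
  qed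
  then show ?thesis
    unfolding quot_proj_def
    using K.a_setmult_rcos_assoc[OF J.a_subset K.a_subset assms(4)] by simp
qed

lemma quot_proj_ring_hom:
  assumes "ideal K R" "ideal J R" "K \<subseteq> J"
  shows "quot_proj R J \<in> ring_hom (R Quot K) (R Quot J)"
proof -
  interpret K: ideal K R by fact
  interpret J: ideal J R by fact
  show ?thesis
    by (rule ring_hom_memI)
      (auto simp: FactRing_simps K.rcoset_mult_add J.rcoset_mult_add K.a_rcos_sum J.a_rcos_sum
        quot_proj_coset[OF assms])
qed

lemma completion_cring:
  assumes "cring R" "ring_filtration R I"
  shows "cring (completion R I)"
proof -
  have idl: "ideal (I j) R" for j using assms(2) by (simp add: ring_filtration_def)
  have Q: "cring (R Quot I j)" for j using ideal.quotient_is_cring[OF idl assms(1)] .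
  have R: "ring (R Quot I j)" for j using Q by (rule cring.axioms)
  have h: "ring_hom_ring (R Quot I j) (R Quot I i) (quot_proj R (I i))" if "i \<le> j" for i j
    using quot_proj_ring_hom[OF idl idl ring_filtration_antimono[OF assms(2) that]]
    by (intro ring_hom_ringI2 R)
  note hs = ring_hom_ring.homh[OF h]
  have ah: "abelian_group_hom (R Quot I j) (R Quot I i) (quot_proj R (I i))" if "i \<le> j" for i j
  proof -
    interpret ring_hom_ring "R Quot I j" "R Quot I i" "quot_proj R (I i)" using that by (rule h)
    show ?thesis by (rule abelian_group_hom_axioms)
  qed
  let ?C = "completion R I"
  have neg: "\<exists>y\<in>carrier ?C. y \<oplus>\<^bsub>?C\<^esub> x = \<zero>\<^bsub>?C\<^esub>" if x: "x \<in> carrier ?C" for x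
  proof (intro bexI)
    let ?y = "\<lambda>j. \<ominus>\<^bsub>R Quot I j\<^esub> x j"
    show "?y \<oplus>\<^bsub>?C\<^esub> x = \<zero>\<^bsub>?C\<^esub>"
      using x by (auto simp: completion_def fun_eq_iff intro!: abelian_group.l_neg ring.is_abelian_group R)
    show "?y \<in> carrier ?C"
      using x abelian_group.a_inv_closed[OF ring.is_abelian_group[OF R]]
        abelian_group_hom.hom_a_inv[OF ah]
      by (auto simp: completion_def)
  qed
  show ?thesis
  proof (rule cringI)
    show "abelian_group ?C"
    proof (rule abelian_groupI)
      show "x \<oplus>\<^bsub>?C\<^esub> y \<in> carrier ?C" if "x \<in> carrier ?C" "y \<in> carrier ?C" for x y
        using that by (auto simp: completion_def ring_hom_add[OF hs] ring.ring_simprules(1) R)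
      show "\<zero>\<^bsub>?C\<^esub> \<in> carrier ?C"
        by (auto simp: completion_def ring_hom_zero[OF hs R R] ring.ring_simprules(2) R)
      show "x \<oplus>\<^bsub>?C\<^esub> y \<oplus>\<^bsub>?C\<^esub> z = x \<oplus>\<^bsub>?C\<^esub> (y \<oplus>\<^bsub>?C\<^esub> z)"
        if "x \<in> carrier ?C" "y \<in> carrier ?C" "z \<in> carrier ?C" for x y z
        using that by (simp add: completion_def ring.ring_simprules(7) R)
      show "x \<oplus>\<^bsub>?C\<^esub> y = y \<oplus>\<^bsub>?C\<^esub> x" if "x \<in> carrier ?C" "y \<in> carrier ?C" for x y
        using that by (simp add: completion_def ring.ring_simprules(10)[OF R])
      show "\<zero>\<^bsub>?C\<^esub> \<oplus>\<^bsub>?C\<^esub> x = x" if "x \<in> carrier ?C" for x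
        using that by (simp add: completion_def ring.ring_simprules(8) R)
    qed (rule neg)
    show "comm_monoid ?C"
    proof (rule comm_monoidI)
      show "x \<otimes>\<^bsub>?C\<^esub> y \<in> carrier ?C" if "x \<in> carrier ?C" "y \<in> carrier ?C" for x y
        using that by (auto simp: completion_def ring_hom_mult[OF hs] ring.ring_simprules(5) R)
      show "\<one>\<^bsub>?C\<^esub> \<in> carrier ?C"
        by (auto simp: completion_def ring_hom_one[OF hs] ring.ring_simprules(6) R)
      show "x \<otimes>\<^bsub>?C\<^esub> y \<otimes>\<^bsub>?C\<^esub> z = x \<otimes>\<^bsub>?C\<^esub> (y \<otimes>\<^bsub>?C\<^esub> z)"
        if "x \<in> carrier ?C" "y \<in> carrier ?C" "z \<in> carrier ?C" for x y z
        using that by (simp add: completion_def ring.ring_simprules(11) R)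
      show "x \<otimes>\<^bsub>?C\<^esub> y = y \<otimes>\<^bsub>?C\<^esub> x" if "x \<in> carrier ?C" "y \<in> carrier ?C" for x y
        using that by (simp add: completion_def comm_monoid.m_comm[OF cring.axioms(2)[OF Q]])
      show "\<one>\<^bsub>?C\<^esub> \<otimes>\<^bsub>?C\<^esub> x = x" if "x \<in> carrier ?C" for x
        using that by (simp add: completion_def ring.ring_simprules(12) R)
    qed
    show "(x \<oplus>\<^bsub>?C\<^esub> y) \<otimes>\<^bsub>?C\<^esub> z = (x \<otimes>\<^bsub>?C\<^esub> z) \<oplus>\<^bsub>?C\<^esub> (y \<otimes>\<^bsub>?C\<^esub> z)"
      if "x \<in> carrier ?C" "y \<in> carrier ?C" "z \<in> carrier ?C" for x y z
      using that by (simp add: completion_def ring.ring_simprules(13) R)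
  qed
qed

lemma completion_map_ring_hom:
  assumes "ring_filtration R I"
  shows "completion_map R I \<in> ring_hom R (completion R I)"
proof -
  have idl: "ideal (I j) R" for j using assms by (simp add: ring_filtration_def)
  note hs = ideal.rcos_ring_hom[OF idl]
  show ?thesis
    by (rule ring_hom_memI)
      (auto simp: completion_def completion_map_def fun_eq_iff ring_hom_closed[OF hs]
        ring_hom_add[OF hs] ring_hom_mult[OF hs] ring_hom_one[OF hs]
        quot_proj_coset[OF idl idl ring_filtration_antimono[OF assms]])
qed

lemma extended_filtration:
  assumes "cring R" "cring S" "\<phi> \<in> ring_hom R S" "\<phi> ` carrier R = carrier S"
    and I: "ring_filtration R I"
  shows "ring_filtration S (\<lambda>j. extended_ideal S (\<phi> ` I j))"
proof -
  interpret R: cring R by fact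
  interpret S: cring S by fact
  interpret ring_hom_ring R S \<phi> by (intro ring_hom_ringI2 R.ring_axioms S.ring_axioms assms(3))
  have idl: "ideal (\<phi> ` I j) S" for j
  proof (rule idealI[OF S.ring_axioms])
    interpret Ij: ideal "I j" R using I by (simp add: ring_filtration_def)
    show "subgroup (\<phi> ` I j) (add_monoid S)"
      by (rule img_is_add_subgroup) (rule Ij.a_subgroup)
    show "x \<otimes>\<^bsub>S\<^esub> a \<in> \<phi> ` I j" "a \<otimes>\<^bsub>S\<^esub> x \<in> \<phi> ` I j"
      if a: "a \<in> \<phi> ` I j" and x: "x \<in> carrier S" for a x
    proof -
      obtain i r where "i \<in> I j" "a = \<phi> i" "r \<in> carrier R" "x = \<phi> r" using a x assms(4) by blast
      then have "x \<otimes>\<^bsub>S\<^esub> a = \<phi> (r \<otimes>\<^bsub>R\<^esub> i)" "a \<otimes>\<^bsub>S\<^esub> x = \<phi> (i \<otimes>\<^bsub>R\<^esub> r)"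
        by (simp_all add: Ij.a_Hcarr)
      then show "x \<otimes>\<^bsub>S\<^esub> a \<in> \<phi> ` I j" "a \<otimes>\<^bsub>S\<^esub> x \<in> \<phi> ` I j"
        using \<open>i \<in> I j\<close> \<open>r \<in> carrier R\<close> Ij.I_l_closed Ij.I_r_closed by blast+
    qed
  qed
  then have ext: "extended_ideal S (\<phi> ` I j) = \<phi> ` I j" for j
    unfolding extended_ideal_def by (rule S.ideal_prod_one)
  have "I 0 = carrier R" and "I (Suc j) \<subseteq> I j" for j
    using I unfolding ring_filtration_def by blast+
  then show ?thesis
    unfolding ring_filtration_def ext using idl assms(4) by (metis image_mono)
qed

lemma preimage_filtration:
  assumes "cring R" "cring S" "\<phi> \<in> ring_hom R S" and J: "ring_filtration S J"
  shows "ring_filtration R (\<lambda>j. preimage_ideal R \<phi> (J j))"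
proof -
  interpret R: cring R by fact
  interpret S: cring S by fact
  interpret ring_hom_ring R S \<phi> by (intro ring_hom_ringI2 R.ring_axioms S.ring_axioms assms(3))
  show ?thesis
    using J ideal_vimage by (auto simp: ring_filtration_def preimage_ideal_def)
qed

end

theory Submission
  imports Defs
begin

text \<open>Surjectivity of the completion map means that every sequence with
  \<open>x (Suc j) \<ominus> x j \<in> I j\<close> has a limit. In part 1 such a sequence in the quotient
  ring lifts to one in \<open>R\<close> by lifting its successive differences into the ideals \<open>I j\<close>,
  and the limit of the lift is mapped to a limit; in part 2 a limit of the image sequence
  is lifted arbitrarily.\<close>

definition filtration_complete :: "('a, 'm) ring_scheme \<Rightarrow> (nat \<Rightarrow> 'a set) \<Rightarrow> bool" where
  "filtration_complete R I \<longleftrightarrow>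
     (\<forall>x. (\<forall>j. x j \<in> carrier R) \<longrightarrow> (\<forall>j. x (Suc j) \<ominus>\<^bsub>R\<^esub> x j \<in> I j) \<longrightarrow>
        (\<exists>r\<in>carrier R. \<forall>j. r \<ominus>\<^bsub>R\<^esub> x j \<in> I j))"

text \<open>Consecutive differences are enough for coherence: beyond index \<open>i\<close> every
  step lies in some \<open>I j\<close> contained in \<open>I i\<close>, so the coset modulo
  \<open>I i\<close> no longer changes.\<close>

lemma completion_map_coset_seq:
  assumes R: "cring R" and I: "ring_filtration R I"
    and x: "\<And>j. x j \<in> carrier R" and d: "\<And>j. x (Suc j) \<ominus>\<^bsub>R\<^esub> x j \<in> I j"
  shows "(\<lambda>j. I j +>\<^bsub>R\<^esub> x j) \<in> carrier (completion R I)"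
proof -
  interpret cring R by fact
  have idl: "ideal (I j) R" for j using I by (simp add: ring_filtration_def)
  have coh: "I i +>\<^bsub>R\<^esub> x j = I i +>\<^bsub>R\<^esub> x i" if "i \<le> j" for i j
    using that
  proof (induction j rule: dec_induct)
    case (step j)
    have "x (Suc j) \<ominus>\<^bsub>R\<^esub> x j \<in> I i"
      using d ring_filtration_antimono[OF I \<open>i \<le> j\<close>] by blast
    then show ?case using step.IH quotient_eq_iff_same_a_r_cos[OF idl x x] by simp
  qed simp
  have "I j +>\<^bsub>R\<^esub> x j \<in> carrier (R Quot I j)" for j
    using ring_hom_closed[OF ideal.rcos_ring_hom[OF idl] x] .
  moreover have "quot_proj R (I i) (I j +>\<^bsub>R\<^esub> x j) = I i +>\<^bsub>R\<^esub> x i" if "i \<le> j" for i j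
    using quot_proj_coset[OF idl idl ring_filtration_antimono[OF I that] x] coh[OF that] by (rule trans)
  ultimately show ?thesis unfolding completion_def by simp
qed

text \<open>A point of the completion amounts to a sequence of representatives, and \<open>r\<close>
  maps to it exactly when \<open>r\<close> is congruent to the \<open>j\<close>-th representative
  modulo \<open>I j\<close> for every \<open>j\<close>. This removes quotient rings from the
  remaining arguments.\<close>

lemma completion_map_surj_iff:
  assumes R: "cring R" and I: "ring_filtration R I"
  shows "completion_map R I ` carrier R = carrier (completion R I) \<longleftrightarrow>
    filtration_complete R I"
proof -
  interpret cring R by fact
  have idl: "ideal (I j) R" for j using I by (simp add: ring_filtration_def)
  note eq_iff = quotient_eq_iff_same_a_r_cos[OF idl]
  show ?thesis
  proof
    assume surj: "completion_map R I ` carrier R = carrier (completion R I)"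
    show "filtration_complete R I"
      unfolding filtration_complete_def
    proof (intro allI impI)
      fix x assume x: "\<forall>j. x j \<in> carrier R" and d: "\<forall>j. x (Suc j) \<ominus>\<^bsub>R\<^esub> x j \<in> I j"
      have "(\<lambda>j. I j +>\<^bsub>R\<^esub> x j) \<in> completion_map R I ` carrier R"
        unfolding surj using x d by (intro completion_map_coset_seq R I) auto
      then obtain r where r: "r \<in> carrier R" "(\<lambda>j. I j +>\<^bsub>R\<^esub> x j) = completion_map R I r"
        by blast
      then have "I j +>\<^bsub>R\<^esub> r = I j +>\<^bsub>R\<^esub> x j" for j
        by (simp add: completion_map_def fun_eq_iff)
      then show "\<exists>r\<in>carrier R. \<forall>j. r \<ominus>\<^bsub>R\<^esub> x j \<in> I j"
        using r(1) x eq_iff by blast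
    qed
  next
    assume compl: "filtration_complete R I"
    show "completion_map R I ` carrier R = carrier (completion R I)"
    proof
      show "completion_map R I ` carrier R \<subseteq> carrier (completion R I)"
        using ring_hom_closed[OF completion_map_ring_hom[OF I]] by blast
      show "carrier (completion R I) \<subseteq> completion_map R I ` carrier R"
      proof
        fix X assume X: "X \<in> carrier (completion R I)"
        then have "\<forall>j. \<exists>a\<in>carrier R. X j = I j +>\<^bsub>R\<^esub> a"
          by (auto simp: completion_def FactRing_def A_RCOSETS_def')
        then obtain x where x: "\<And>j. x j \<in> carrier R" and Xx: "\<And>j. X j = I j +>\<^bsub>R\<^esub> x j"
          by metis
        \<comment> \<open>The representatives are arbitrary; coherence of \<open>X\<close> between
          the levels \<open>Suc j\<close> and \<open>j\<close> alone controls their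
          difference.\<close>
        have "x (Suc j) \<ominus>\<^bsub>R\<^esub> x j \<in> I j" for j
        proof -
          have "quot_proj R (I j) (X (Suc j)) = X j"
            using X by (simp add: completion_def)
          then have "I j +>\<^bsub>R\<^esub> x (Suc j) = I j +>\<^bsub>R\<^esub> x j"
            by (simp add: Xx x quot_proj_coset[OF idl idl ring_filtration_antimono[OF I]])
          then show ?thesis using eq_iff[OF x x] by simp
        qed
        then obtain r where r: "r \<in> carrier R" "\<And>j. r \<ominus>\<^bsub>R\<^esub> x j \<in> I j"
          using compl x unfolding filtration_complete_def by blast
        then have "X = completion_map R I r"
          using eq_iff[OF r(1) x] by (simp add: completion_map_def fun_eq_iff Xx)
        then show "X \<in> completion_map R I ` carrier R" using r(1) by blast
      qed
    qed
  qed
qed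

text \<open>Absorption needs surjectivity: a multiplier from \<open>S\<close> is some
  \<open>h r\<close>, so the product is the image of a product in \<open>R\<close>.\<close>

lemma (in ring_hom_ring) ideal_image_surj:
  assumes "ideal I R" and surj: "h ` carrier R = carrier S"
  shows "ideal (h ` I) S"
proof (rule idealI[OF S.ring_axioms])
  interpret I: ideal I R by fact
  show "subgroup (h ` I) (add_monoid S)"
    by (rule img_is_add_subgroup) (rule I.a_subgroup)
  show "x \<otimes>\<^bsub>S\<^esub> a \<in> h ` I" "a \<otimes>\<^bsub>S\<^esub> x \<in> h ` I"
    if a: "a \<in> h ` I" and x: "x \<in> carrier S" for a x
  proof -
    obtain i r where ir: "i \<in> I" "a = h i" "r \<in> carrier R" "x = h r"
      using a x surj by blast
    then have "x \<otimes>\<^bsub>S\<^esub> a = h (r \<otimes> i)" "a \<otimes>\<^bsub>S\<^esub> x = h (i \<otimes> r)"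
      by (simp_all add: I.a_Hcarr)
    then show "x \<otimes>\<^bsub>S\<^esub> a \<in> h ` I" "a \<otimes>\<^bsub>S\<^esub> x \<in> h ` I"
      using ir I.I_l_closed I.I_r_closed by blast+
  qed
qed

text \<open>Arbitrary lifts of the terms \<open>y j\<close> would have differences in
  \<open>I j\<close> only up to the kernel of \<open>h\<close>; hence the differences are lifted and
  then summed.\<close>

lemma (in ring_hom_ring) filtration_complete_image:
  assumes I: "ring_filtration R I" and surj: "h ` carrier R = carrier S"
    and compl: "filtration_complete R I"
  shows "filtration_complete S (\<lambda>j. h ` I j)"
  unfolding filtration_complete_def
proof (intro allI impI)
  fix y assume y: "\<forall>j. y j \<in> carrier S" and dy: "\<forall>j. y (Suc j) \<ominus>\<^bsub>S\<^esub> y j \<in> h ` I j"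
  have IR: "a \<in> carrier R" if "a \<in> I j" for a j
    using I that by (meson ideal.Icarr ring_filtration_def)
  have "\<forall>j. \<exists>d\<in>I j. y (Suc j) \<ominus>\<^bsub>S\<^esub> y j = h d" using dy by blast
  then obtain d where d: "\<And>j. d j \<in> I j" and hd: "\<And>j. y (Suc j) \<ominus>\<^bsub>S\<^esub> y j = h (d j)"
    by metis
  obtain a where a: "a \<in> carrier R" "h a = y 0" using y surj by (metis imageE)
  \<comment> \<open>Partial sums: \<open>x j\<close> is \<open>a\<close> plus the terms
    \<open>d i\<close> with \<open>i < j\<close>. Under \<open>h\<close> the sum telescopes to
    \<open>y j\<close>.\<close>
  define x where "x = rec_nat a (\<lambda>j z. d j \<oplus> z)"
  have x0: "x 0 = a" and xS: "x (Suc j) = d j \<oplus> x j" for j by (simp_all add: x_def)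
  have x: "x j \<in> carrier R" for j by (induction j) (auto simp: x0 xS a IR[OF d])
  have hx: "h (x j) = y j" for j
  proof (induction j)
    case (Suc j)
    have "h (x (Suc j)) = (y (Suc j) \<ominus>\<^bsub>S\<^esub> y j) \<oplus>\<^bsub>S\<^esub> y j"
      by (simp add: xS x IR[OF d] Suc hd)
    then show ?case using y by (simp add: S.minus_eq S.a_assoc S.l_neg)
  qed (simp add: x0 a)
  have "x (Suc j) \<ominus> x j \<in> I j" for j
    using d[of j] x[of j] by (simp add: xS IR[OF d] R.minus_eq R.a_assoc R.r_neg)
  then obtain r where r: "r \<in> carrier R" "\<And>j. r \<ominus> x j \<in> I j"
    using compl x unfolding filtration_complete_def by blast
  have "h r \<ominus>\<^bsub>S\<^esub> y j = h (r \<ominus> x j)" for j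
    using r x by (simp add: R.minus_eq S.minus_eq hx)
  then show "\<exists>s\<in>carrier S. \<forall>j. s \<ominus>\<^bsub>S\<^esub> y j \<in> h ` I j"
    using r by (intro bexI[of _ "h r"]) auto
qed

text \<open>Membership in a preimage ideal is tested after applying \<open>h\<close>, so the
  hypothesis and the conclusion on \<open>x\<close> both translate to the image sequence, and any
  lift of its limit serves.\<close>

lemma (in ring_hom_ring) filtration_complete_preimage:
  assumes surj: "h ` carrier R = carrier S" and compl: "filtration_complete S J"
  shows "filtration_complete R (\<lambda>j. preimage_ideal R h (J j))"
  unfolding filtration_complete_def
proof (intro allI impI)
  fix x assume x: "\<forall>j. x j \<in> carrier R"
    and d: "\<forall>j. x (Suc j) \<ominus> x j \<in> preimage_ideal R h (J j)"
  have h_minus: "h (a \<ominus> b) = h a \<ominus>\<^bsub>S\<^esub> h b" if "a \<in> carrier R" "b \<in> carrier R" for a b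
    using that by (simp add: R.minus_eq S.minus_eq)
  have "\<forall>j. h (x j) \<in> carrier S" "\<forall>j. h (x (Suc j)) \<ominus>\<^bsub>S\<^esub> h (x j) \<in> J j"
    using x d by (auto simp: preimage_ideal_def h_minus)
  then obtain s where s: "s \<in> carrier S" "\<And>j. s \<ominus>\<^bsub>S\<^esub> h (x j) \<in> J j"
    using compl[unfolded filtration_complete_def, rule_format, of "\<lambda>j. h (x j)"] by blast
  obtain r where r: "r \<in> carrier R" "h r = s" using s(1) surj by (metis imageE)
  have "r \<ominus> x j \<in> preimage_ideal R h (J j)" for j
    using s(2)[of j] x r by (simp add: preimage_ideal_def h_minus)
  then show "\<exists>r\<in>carrier R. \<forall>j. r \<ominus> x j \<in> preimage_ideal R h (J j)"
    using r(1) by blast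
qed

theorem lemma2p8:
  fixes R :: "('a, 'm) ring_scheme" and S :: "('b, 'n) ring_scheme" and \<phi> :: "'a \<Rightarrow> 'b"
  assumes "cring R" and "cring S"
    and "\<phi> \<in> ring_hom R S" and "\<phi> ` carrier R = carrier S"
  shows "(\<forall>I. ring_filtration R I \<longrightarrow>
            completion_map R I ` carrier R = carrier (completion R I) \<longrightarrow>
            completion_map S (\<lambda>j. extended_ideal S (\<phi> ` I j)) ` carrier S
              = carrier (completion S (\<lambda>j. extended_ideal S (\<phi> ` I j)))) \<and>
         (\<forall>J. ring_filtration S J \<longrightarrow>
            completion_map S J ` carrier S = carrier (completion S J) \<longrightarrow>
            completion_map R (\<lambda>j. preimage_ideal R \<phi> (J j)) ` carrier R
              = carrier (completion R (\<lambda>j. preimage_ideal R \<phi> (J j))))"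
proof -
  interpret R: cring R by fact
  interpret S: cring S by fact
  interpret ring_hom_ring R S \<phi> by (intro ring_hom_ringI2 R.ring_axioms S.ring_axioms assms(3))
  have "filtration_complete S (\<lambda>j. extended_ideal S (\<phi> ` I j))"
    if I: "ring_filtration R I" and compl: "filtration_complete R I" for I
  proof -
    \<comment> \<open>The image is already an ideal because \<open>\<phi>\<close> is onto, so
      multiplying it by the unit ideal changes nothing.\<close>
    have "extended_ideal S (\<phi> ` I j) = \<phi> ` I j" for j
      using I unfolding extended_ideal_def
      by (intro S.ideal_prod_one ideal_image_surj assms(4)) (simp add: ring_filtration_def)
    then show ?thesis using filtration_complete_image[OF I assms(4) compl] by simp
  qed
  \<comment> \<open>Both induced families are filtrations, so the surjectivity criterion applies to
    each of the four completion maps.\<close>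
  then show ?thesis
    using filtration_complete_preimage[OF assms(4)]
    by (simp add: completion_map_surj_iff assms(1,2) extended_filtration[OF assms]
        preimage_filtration[OF assms(1-3)])
qed

end
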